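(* Consider the opinion dynamics $\dot x=A(x)Ex$ with $E=B-\Sigma$ and $A(x)=\tfrac12\,(I-\mathrm{diag}(x))$ (stubborn positives scenario), with states $x(t)\in[-1,1]^N$ for all $t\ge 0$, where $B\in\mathbb{R}^{N\times N}$ is the adjacency matrix of a strongly connected signed digraph with $b_{ii}=0$ and $\Sigma=\mathrm{diag}\{\sigma_1,\dots,\sigma_N\}$ with all $\sigma_i>0$. Suppose that Assumption 1 holds or Assumption 2 holds (both stated in the context), and that there exists a positive diagonal matrix $\Gamma=\mathrm{diag}\{\gamma_1,\dots,\gamma_N\}$ such that $H(\Gamma E)\preceq 0$ and $\mathrm{rank}\,H(\Gamma E)=\mathrm{rank}\,E$. Let $v_r$ be the right positive eigenvector of $B$ (under Assumption 1), respectively of $C$ (under Assumption 2). Then: 1) If $x(0)<\mathbf 1$, then $\lim_{t\to\infty}x(t)=\alpha v_r$ for some $\alpha\in\big[-\frac{1}{\|v_r\|_\infty},\frac{1}{\|v_r\|_\infty}\big)$. 2) Let $\mathcal I_{a,0}\subset\{1,\dots,N\}$ with $\mathcal I_{a,0}\ne\varnothing$ and complement $\mathcal I_{a,+}\neq\varnothing$, and let $P$ be a permutation matrix such that $y=Px=\begin{bmatrix}y_1\\ y_2\end{bmatrix}$, where $y_1$ collects the coordinates $x_i$ with $i\in\mathcal I_{a,0}$ and $y_2$ the remaining ones; write $PEP^{\mathrm T}=\begin{bmatrix}\bar E_{11}&\bar E_{12}\\ \bar E_{21}&\bar E_{22}\end{bmatrix}$ conformally. If $\bar E_{22}$ is nonsingular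 and $-\mathbf 1\le -\bar E_{22}^{-1}\bar E_{21}\mathbf 1<\mathbf 1$, then $\lim_{t\to\infty}x(t)=x^\ast$ for all $x(0)\in\{x\mid x_i=1\ \forall i\in\mathcal I_{a,0},\ x_i\in[-1,1)\ \forall i\notin\mathcal I_{a,0}\}$, where $x^\ast=P^{\mathrm T}y^\ast$ and $y^\ast=\begin{bmatrix}\mathbf 1\\ -\bar E_{22}^{-1}\bar E_{21}\mathbf 1\end{bmatrix}$. 3) If $\sigma_i=\sigma_j=\rho(B)$ for all $i,j=1,\dots,N$ (under Assumption 1), respectively $d=\rho(C)$ (under Assumption 2), and $v_r\ne\mathbf 1$, then every solution starting in $\{x\mid x_i=1\ \forall i\in\mathcal J,\ x_i\in[-1,1)\ \forall i\notin\mathcal J\}$ converges to $\beta v_r$ as $t\to\infty$, where $\mathcal J=\{j\mid v_{rj}=\|v_r\|_\infty\}$ and $\beta=\frac{1}{\|v_r\|_\infty}$.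
   Context: Notation. $\mathbf 1$ is the all-ones vector; vector inequalities are entrywise ($x<y$ means $x_i<y_i$ for all $i$). $\mathrm{diag}(x)$ is the diagonal matrix with diagonal entries $x_1,\dots,x_N$. $\|x\|_\infty=\max_i|x_i|$. $\rho(\cdot)$ is the spectral radius. $H(M)=\frac12(M+M^{\mathrm T})$; $\preceq 0$ means negative semidefinite. A real square matrix $M$ is eventually positive if there is a positive integer $k_0$ such that $M^k$ has all entries strictly positive for every $k\ge k_0$. Model. Agent states satisfy $x_i(t)\in[-1,1]$ (standing assumption: solutions are considered with values in $[-1,1]^N$ for all $t\ge0$). $B=[b_{ij}]$ is a real matrix (entries of either sign) with $b_{ii}=0$ that is the adjacency matrix of a strongly connected signed digraph, i.e. $B$ is irreducible. $\sigma_i>0$ for all $i$. $E=B-\Sigma$. Assumption 1. $B$ is eventually positive, and $\sigma_i=\sigma_j\ge\rho(B)$ for all $i,j=1,\dots,N$. Assumption 2. $B$ is not eventually positive, and $E$ can be written as $E=C-dI$, where $C=B+D$ is eventually positive, $D=dI-\Sigma$, and $d\ge\rho(C)$. The spectral radius of an eventually positive matrix is a simple positive eigenvalue with an entrywise positive right eigenvector (unique up to positive scaling); $v_r$ denotes this eigenvector of $B$ (Assumption 1) or of $C$ (Assumption 2), and $v_{rj}$ is its $j$th entry. The set $\mathcal I_{a,0}$ is the set of indices $i$ at which the susceptibility $a_i(x_i)=\tfrac12(1-x_i)$ vanishes at the initial state, and $\mathcal I_{a,+}$ is the set of indices at which it is positive. *)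

theory Defs
  imports "HOL-Analysis.Analysis"
begin

section \<open>Matrix notions\<close>

text \<open>Multiplication, and hence the power operation, on the type of vectors of vectors is
  componentwise, so powers with respect to the matrix product are defined here.\<close>

primrec mat_power :: "real^'n^'n \<Rightarrow> nat \<Rightarrow> real^'n^'n" where
  "mat_power M 0 = mat 1"
| "mat_power M (Suc k) = M ** mat_power M k"

definition eventually_positive :: "real^'n^'n \<Rightarrow> bool" where
  "eventually_positive M \<longleftrightarrow> (\<exists>k0>0. \<forall>k\<ge>k0. \<forall>i j. 0 < mat_power M k $ i $ j)"

definition eigenvalues :: "real^'n^'n \<Rightarrow> complex set" where
  "eigenvalues M = {l. \<exists>w. w \<noteq> 0 \<and> map_matrix complex_of_real M *v w = l *s w}"

definition spectral_radius :: "real^'n^'n \<Rightarrow> real" where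
  "spectral_radius M = Max (cmod ` eigenvalues M)"

definition diag :: "real^'n \<Rightarrow> real^'n^'n" where
  "diag x = (\<chi> i j. if i = j then x $ i else 0)"

definition symmetric_part :: "real^'n^'n \<Rightarrow> real^'n^'n" where
  "symmetric_part M = (1/2) *\<^sub>R (M + transpose M)"

definition negative_semidefinite :: "real^'n^'n \<Rightarrow> bool" where
  "negative_semidefinite M \<longleftrightarrow> transpose M = M \<and> (\<forall>x. x \<bullet> (M *v x) \<le> 0)"

definition positive_vector :: "real^'n \<Rightarrow> bool" where
  "positive_vector v \<longleftrightarrow> (\<forall>i. 0 < v $ i)"

definition perron_vector :: "real^'n^'n \<Rightarrow> real^'n \<Rightarrow> bool" where
  "perron_vector M v \<longleftrightarrow> positive_vector v \<and> M *v v = spectral_radius M *\<^sub>R v"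

text \<open>The signed digraph of \<open>B\<close> has an arc from \<open>j\<close> to \<open>i\<close>, of weight \<open>B $ i $ j\<close>,
  whenever this entry is nonzero.\<close>

definition arcs :: "real^'n^'n \<Rightarrow> ('n \<times> 'n) set" where
  "arcs B = {(j, i). B $ i $ j \<noteq> 0}"

definition strongly_connected :: "real^'n^'n \<Rightarrow> bool" where
  "strongly_connected B \<longleftrightarrow> (\<forall>i j. (i, j) \<in> (arcs B)\<^sup>*)"


section \<open>The standing alternatives on the system matrix\<close>

definition assumption1 :: "real^'n^'n \<Rightarrow> real^'n \<Rightarrow> bool" where
  "assumption1 B \<sigma> \<longleftrightarrow> eventually_positive B \<and>
     (\<forall>i j. \<sigma> $ i = \<sigma> $ j \<and> \<sigma> $ j \<ge> spectral_radius B)"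

definition assumption2 :: "real^'n^'n \<Rightarrow> real^'n \<Rightarrow> real^'n^'n \<Rightarrow> real \<Rightarrow> bool" where
  "assumption2 B \<sigma> C d \<longleftrightarrow> \<not> eventually_positive B \<and>
     B - diag \<sigma> = C - mat d \<and> C = B + (mat d - diag \<sigma>) \<and>
     eventually_positive C \<and> d \<ge> spectral_radius C"


section \<open>The opinion dynamics\<close>

definition susceptibility :: "real^'n \<Rightarrow> real^'n^'n" where
  "susceptibility x = (1/2) *\<^sub>R (mat 1 - diag x)"

text \<open>Solutions on \<open>[0, \<infinity>)\<close> with values in \<open>[-1, 1]\<^sup>N\<close>; the derivative at time 0 is one-sided.\<close>

definition solution :: "real^'n^'n \<Rightarrow> (real \<Rightarrow> real^'n) \<Rightarrow> bool" where
  "solution E x \<longleftrightarrow>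
     (\<forall>t\<ge>0. (x has_vector_derivative (susceptibility (x t) ** E) *v x t) (at t within {0..})) \<and>
     (\<forall>t\<ge>0. \<forall>i. -1 \<le> x t $ i \<and> x t $ i \<le> 1)"


section \<open>Permutations into two blocks\<close>

text \<open>Vectors split into two blocks are indexed by a sum type, the summands indexing the first and
  the second block. A bijection from the sum type to \<open>'n\<close> lists the coordinates
  in their new order; its permutation matrix \<open>P\<close> satisfies \<open>(P *v x) $ k = x $ \<pi> k\<close>.\<close>

definition perm_matrix :: "('p + 'q \<Rightarrow> 'n) \<Rightarrow> real^'n^('p::finite + 'q::finite)" where
  "perm_matrix \<pi> = (\<chi> k i. if i = \<pi> k then 1 else 0)"

definition block21 :: "real^('p + 'q)^('p + 'q) \<Rightarrow> real^('p::finite)^('q::finite)" where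
  "block21 M = (\<chi> i j. M $ Inr i $ Inl j)"

definition block22 :: "real^('p + 'q)^('p::finite + 'q) \<Rightarrow> real^('q::finite)^'q" where
  "block22 M = (\<chi> i j. M $ Inr i $ Inr j)"

definition join_blocks :: "real^'p \<Rightarrow> real^'q \<Rightarrow> real^('p::finite + 'q::finite)" where
  "join_blocks y1 y2 = (\<chi> k. case k of Inl i \<Rightarrow> y1 $ i | Inr i \<Rightarrow> y2 $ i)"

end

(* With the Perron vector v, the system matrix is E = M - s I with M eventually positive and
   s at least the Perron root of M, so comparison with v through a strictly positive power of M
   gives ker E \<subseteq> span v. The rank condition upgrades H(\<Gamma>E) \<preceq> 0 to: x . \<Gamma>E x = 0 implies E x = 0.

   Let S be the set of coordinates starting at 1; they stay at 1 and the others stay below 1.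
   If a is 1 on S, below 1 off S, and (E a)_i = 0 off S, then the sum over i not in S of
   2 \<gamma>_i (1 - a_i) (u_i - 1 - ln u_i) with u_i = (1 - x_i) / (1 - a_i) has derivative
   (x - a) . \<Gamma>E (x - a) \<le> 0 along solutions, and by Barbalat's argument every limit point w
   satisfies E (w - a) = 0. If S is nonempty, w - a is a multiple of v with a zero entry, so w = a.
   If S is empty, take a = 0 first to get a limit point on the line spanned by v, and then use
   the Lyapunov function centred at this limit point. *)

theory Submission
  imports Defs
begin

section \<open>Perron vectors and dissipative matrices\<close>

lemma mat_power_eigenvector:
  assumes "M *v w = s *\<^sub>R w"
  shows "mat_power M k *v w = s ^ k *\<^sub>R w"
proof (induction k)
  case (Suc k)
  have "mat_power M (Suc k) *v w = M *v (mat_power M k *v w)"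
    by (simp add: matrix_vector_mul_assoc)
  also have "\<dots> = s ^ Suc k *\<^sub>R w"
    using Suc assms by (simp add: matrix_vector_mult_scaleR)
  finally show ?case .
qed simp

text \<open>The vector \<open>c v - w\<close> is nonnegative and vanishes at \<open>j\<close>. Row
  \<open>j\<close> of \<open>P\<close> maps it to a sum of nonnegative terms, while the eigenvector
  equations give \<open>(p - q) c v_j\<close>, which is at most 0; as the row is strictly positive,
  every entry is 0.\<close>

lemma positive_matrix_touching_eigenvector:
  fixes P :: "real^'n^'n"
  assumes P: "\<And>i j. 0 < P $ i $ j" and v: "positive_vector v"
    and Pv: "P *v v = p *\<^sub>R v" and Pw: "P *v w = q *\<^sub>R w" and pq: "p \<le> q"
    and w: "\<And>i. w $ i \<le> c * v $ i" and j: "w $ j = c * v $ j" and c: "0 \<le> c"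
  shows "w = c *\<^sub>R v"
proof -
  define u where "u = c *\<^sub>R v - w"
  have u0: "0 \<le> u $ i" for i using w[of i] by (simp add: u_def)
  have "P *v u = (c * p) *\<^sub>R v - q *\<^sub>R w"
    by (simp add: u_def matrix_vector_mult_diff_distrib matrix_vector_mult_scaleR Pv Pw)
  then have "(P *v u) $ j = c * p * v $ j - q * (c * v $ j)"
    by (simp only: vector_minus_component vector_scaleR_component j real_scaleR_def)
  also have "\<dots> = (p - q) * (c * v $ j)"
    by (simp add: algebra_simps)
  also have "\<dots> \<le> 0"
    using pq c v by (auto simp: positive_vector_def mult_le_0_iff less_imp_le)
  finally have "(\<Sum>i\<in>UNIV. P $ j $ i * u $ i) \<le> 0"
    by (simp add: matrix_vector_mult_def)
  moreover have nn: "0 \<le> P $ j $ i * u $ i" for i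
    using P[of j i] u0[of i] by simp
  ultimately have "(\<Sum>i\<in>UNIV. P $ j $ i * u $ i) = 0"
    by (meson order_antisym sum_nonneg)
  then have "P $ j $ i * u $ i = 0" for i
    using nn by (simp add: sum_nonneg_eq_0_iff)
  then have "u $ i = 0" for i
    using P[of j i] by (metis less_irrefl mult_eq_0_iff)
  then show ?thesis by (simp add: u_def vec_eq_iff)
qed

text \<open>A strictly positive power of \<open>M\<close> turns both relations into eigenvector
  equations of a positive matrix, and the least multiple of \<open>v\<close> dominating
  \<open>|w|\<close> touches \<open>w\<close> or \<open>- w\<close>. Allowing \<open>r < s\<close>
  covers shifts above the Perron root, where \<open>w\<close> is forced to be 0.\<close>

lemma eventually_positive_eigenvector:
  fixes M :: "real^'n^'n"
  assumes M: "eventually_positive M" and v: "positive_vector v"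
    and Mv: "M *v v = r *\<^sub>R v" and Mw: "M *v w = s *\<^sub>R w" and rs: "r \<le> s"
  shows "\<exists>c. w = c *\<^sub>R v"
proof -
  obtain k0 where k0: "\<And>k i j. k0 \<le> k \<Longrightarrow> 0 < mat_power M k $ i $ j"
    using M unfolding eventually_positive_def by blast
  \<comment> \<open>The exponent is odd so that \<open>0 < r ^ k\<close> yields \<open>0 < r\<close>.\<close>
  define k where "k = 2 * k0 + 1"
  define P where "P = mat_power M k"
  have P: "0 < P $ i $ j" for i j
    unfolding P_def by (rule k0) (simp add: k_def)
  have Pv: "P *v v = r ^ k *\<^sub>R v" and Pw: "P *v w = s ^ k *\<^sub>R w"
    unfolding P_def by (simp_all add: mat_power_eigenvector Mv Mw)
  have v0: "0 < v $ i" for i using v by (simp add: positive_vector_def)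
  have "0 < r"
  proof -
    have "0 < (P *v v) $ i" for i
      unfolding matrix_vector_mult_def by (simp add: P v0 sum_pos)
    then have "0 < r ^ k * v $ i" for i by (simp add: Pv)
    then have "0 < r ^ k" using v0 by (meson zero_less_mult_pos2)
    then show ?thesis
      by (simp add: zero_less_power_eq k_def del: power_Suc)
  qed
  with rs have pq: "r ^ k \<le> s ^ k" by (simp add: power_mono)
  \<comment> \<open>This is the least factor with \<open>|w| \<le> c v\<close> entrywise; an index
    attaining the maximum is the touching point.\<close>
  define c where "c = Max (range (\<lambda>i. \<bar>w $ i\<bar> / v $ i))"
  have "c \<in> range (\<lambda>i. \<bar>w $ i\<bar> / v $ i)" unfolding c_def by (rule Max_in) auto
  then obtain j where j: "c = \<bar>w $ j\<bar> / v $ j" by auto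
  have le: "\<bar>w $ i\<bar> \<le> c * v $ i" for i
  proof -
    have "\<bar>w $ i\<bar> / v $ i \<le> c" unfolding c_def by (rule Max_ge) auto
    then show ?thesis using v0[of i] by (simp add: pos_divide_le_eq)
  qed
  have cj: "\<bar>w $ j\<bar> = c * v $ j" using j v0[of j] by simp
  have c0: "0 \<le> c" using j v0[of j] by simp
  show ?thesis
  proof (cases "0 \<le> w $ j")
    case True
    have "w = c *\<^sub>R v"
      by (rule positive_matrix_touching_eigenvector[OF P v Pv Pw pq _ _ c0, of j])
        (use le cj True in \<open>auto simp: abs_le_iff\<close>)
    then show ?thesis ..
  next
    case False
    have Pw': "P *v (- w) = s ^ k *\<^sub>R (- w)"
      using Pw by (simp add: linear_neg matrix_vector_mul_linear)
    have "- w = c *\<^sub>R v"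
      by (rule positive_matrix_touching_eigenvector[OF P v Pv Pw' pq _ _ c0, of j])
        (use le cj False in \<open>auto simp: abs_le_iff\<close>)
    then have "w = (- c) *\<^sub>R v" by (metis add.inverse_inverse scaleR_minus_left)
    then show ?thesis ..
  qed
qed

section \<open>Kernels, ranks and semidefinite quadratic forms\<close>

lemma kernel_eq_orthogonal_comp_range_transpose:
  fixes A :: "real^'n^'m"
  shows "{x. A *v x = 0} = (range ((*v) (transpose A)))\<^sup>\<bottom>"
  using ker_orthogonal_comp_adjoint[of "(*v) A"] by (auto simp: adjoint_matrix vimage_def)

text \<open>Each kernel is the orthogonal complement of the row space, so the inclusion of kernels
  reverses to an inclusion of row spaces; equal ranks give these the same dimension, hence they
  coincide.\<close>

lemma kernel_eqI_rank:
  fixes A :: "real^'n^'m" and B :: "real^'n^'k"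
  assumes sub: "{x. A *v x = 0} \<subseteq> {x. B *v x = 0}" and rank: "rank A = rank B"
  shows "{x. A *v x = 0} = {x. B *v x = 0}"
proof -
  let ?R = "range ((*v) (transpose A))" and ?S = "range ((*v) (transpose B))"
  have subsp: "subspace ?R" "subspace ?S"
    by (intro linear_subspace_image matrix_vector_mul_linear subspace_UNIV)+
  have "?S\<^sup>\<bottom>\<^sup>\<bottom> \<subseteq> ?R\<^sup>\<bottom>\<^sup>\<bottom>"
    using sub unfolding kernel_eq_orthogonal_comp_range_transpose
    by (rule orthogonal_comp_anti_mono)
  then have "?S \<subseteq> ?R" by (simp only: orthogonal_comp_self subsp)
  moreover have "dim ?R \<le> dim ?S"
    using rank rank_dim_range[of "transpose A"] rank_dim_range[of "transpose B"]
    by (simp only: rank_transpose)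
  ultimately have "?S = ?R" by (intro subspace_dim_equal subsp)
  then show ?thesis by (simp add: kernel_eq_orthogonal_comp_range_transpose)
qed

text \<open>A zero of the form is a maximiser, so the gradient \<open>2 S x\<close> has to vanish:
  otherwise a small step from \<open>x\<close> in the direction \<open>S x\<close> would make the
  form positive.\<close>

lemma negative_semidefinite_kernel:
  assumes "negative_semidefinite S" and x: "x \<bullet> (S *v x) = 0"
  shows "S *v x = 0"
proof (rule ccontr)
  assume ne: "S *v x \<noteq> 0"
  have sym: "transpose S = S" and le: "\<And>x. x \<bullet> (S *v x) \<le> 0"
    using assms(1) by (auto simp: negative_semidefinite_def)
  define y where "y = S *v x"
  define c where "c = y \<bullet> (S *v y)"
  have "x \<bullet> (S *v y) = y \<bullet> y"
    unfolding y_def by (metis sym dot_lmul_matrix inner_commute vector_transpose_matrix)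
  then have eq: "(x + t *\<^sub>R y) \<bullet> (S *v (x + t *\<^sub>R y)) = 2 * t * (y \<bullet> y) + t\<^sup>2 * c" for t
    using x by (simp add: matrix_vector_right_distrib matrix_vector_mult_scaleR inner_add_left
        inner_add_right c_def power2_eq_square algebra_simps flip: y_def)
  have yy: "0 < y \<bullet> y" using ne by (simp add: y_def)
  have c: "c \<le> 0" unfolding c_def by (rule le)
  \<comment> \<open>Chosen so that \<open>t - t c = y \<bullet> y\<close>, which turns the value of
    the form into \<open>t (y \<bullet> y) + t^2\<close>. The denominator is at least 1 because
    \<open>c \<le> 0\<close>.\<close>
  define t where "t = y \<bullet> y / (1 - c)"
  have t: "0 < t" "t * (1 - c) = y \<bullet> y" using yy c by (simp_all add: t_def)
  have "2 * t * (y \<bullet> y) + t\<^sup>2 * c \<le> 0" using le[of "x + t *\<^sub>R y"] eq by simp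
  moreover have "2 * t * (y \<bullet> y) + t\<^sup>2 * c = t * (y \<bullet> y) + t\<^sup>2"
    unfolding t(2)[symmetric] by (simp add: algebra_simps power2_eq_square)
  moreover have "0 < t * (y \<bullet> y) + t\<^sup>2" using t(1) yy by (simp add: add_pos_pos)
  ultimately show False by linarith
qed

lemma inner_symmetric_part: "x \<bullet> (symmetric_part M *v x) = x \<bullet> (M *v x)"
proof -
  have "x \<bullet> (transpose M *v x) = x \<bullet> (M *v x)"
    by (metis dot_lmul_matrix inner_commute transpose_matrix_vector)
  then show ?thesis
    by (simp add: symmetric_part_def matrix_vector_mult_add_rdistrib inner_add_right
        scaleR_matrix_vector_assoc[symmetric])
qed

lemma diag_mult_vec_nth: "((diag g ** E) *v x) $ i = g $ i * (E *v x) $ i"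
proof -
  have "(diag g *v y) $ i = g $ i * y $ i" for y
    by (simp add: diag_def matrix_vector_mult_def if_distrib[of "\<lambda>a. a * _"] cong: if_cong)
  then show ?thesis by (simp flip: matrix_vector_mul_assoc)
qed

lemma quadratic_form_eq:
  "x \<bullet> ((diag g ** E) *v x) = (\<Sum>i\<in>UNIV. g $ i * x $ i * (E *v x) $ i)"
  by (simp add: inner_vec_def diag_mult_vec_nth mult.assoc mult.left_commute)

text \<open>A vector killed by \<open>E\<close> is a zero of the form, so the kernel of
  \<open>E\<close> lies in that of the symmetric part. Equal ranks turn this into equality of
  kernels, which gives the converse.\<close>

lemma quadratic_form_zero_imp_kernel:
  assumes nsd: "negative_semidefinite (symmetric_part (diag g ** E))"
    and rank: "rank (symmetric_part (diag g ** E)) = rank E"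
    and x: "x \<bullet> ((diag g ** E) *v x) = 0"
  shows "E *v x = 0"
proof -
  let ?S = "symmetric_part (diag g ** E)"
  have "{x. E *v x = 0} \<subseteq> {x. ?S *v x = 0}"
  proof safe
    fix y assume "E *v y = 0"
    then have "y \<bullet> (?S *v y) = 0" by (simp add: inner_symmetric_part quadratic_form_eq)
    then show "?S *v y = 0" by (rule negative_semidefinite_kernel[OF nsd])
  qed
  from kernel_eqI_rank[OF this rank[symmetric]] have "{x. E *v x = 0} = {x. ?S *v x = 0}" .
  moreover have "?S *v x = 0"
    using x by (intro negative_semidefinite_kernel[OF nsd]) (simp add: inner_symmetric_part)
  ultimately show ?thesis by auto
qed

lemma matrix_inv_right:
  assumes "invertible A"
  shows "A ** matrix_inv A = mat 1"
proof -
  have "\<exists>A'. A ** A' = mat 1 \<and> A' ** A = mat 1"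
    using assms by (simp add: invertible_def)
  from someI_ex[OF this] show ?thesis by (simp add: matrix_inv_def)
qed

section \<open>Limit points of solutions\<close>

text \<open>Mean value theorem in the form behind all monotonicity arguments below, mostly with
  \<open>k = 0\<close>. Derivatives are taken within \<open>{0..}\<close> to match the one-sided
  derivative at time 0 in \<open>solution\<close>.\<close>

lemma DERIV_within_imp_growth:
  fixes f :: "real \<Rightarrow> real"
  assumes "\<And>t. 0 \<le> t \<Longrightarrow> (f has_real_derivative f' t) (at t within {0..})"
    and "\<And>t. a \<le> t \<Longrightarrow> t \<le> b \<Longrightarrow> k \<le> f' t" and "0 \<le> a" "a \<le> b"
  shows "f a + k * (b - a) \<le> f b"
proof -
  have "\<exists>t\<in>{a..b}. f b - f a = f' t * (b - a)"
  proof (rule mvt_very_simple)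
    fix t assume t: "a \<le> t" "t \<le> b"
    with assms have "(f has_real_derivative f' t) (at t within {a..b})"
      by (intro has_field_derivative_subset[OF assms(1)]) auto
    then show "(f has_derivative (*) (f' t)) (at t within {a..b})"
      by (simp add: has_field_derivative_def)
  qed fact
  then obtain t where "a \<le> t" "t \<le> b" "f b - f a = f' t * (b - a)" by auto
  moreover from this have "k * (b - a) \<le> f' t * (b - a)"
    using assms by (intro mult_right_mono) auto
  ultimately show ?thesis by linarith
qed

text \<open>Whenever \<open>Q\<close> reaches \<open>e\<close>, uniform continuity keeps it above
  \<open>e / 2\<close> for a fixed length of time, which costs \<open>V\<close> a fixed amount; a
  nonnegative \<open>V\<close> can pay this only finitely often.\<close>

lemma barbalat_Lyapunov:
  fixes V Q :: "real \<Rightarrow> real"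
  assumes V': "\<And>t. 0 \<le> t \<Longrightarrow> (V has_real_derivative - Q t) (at t within {0..})"
    and V: "\<And>t. 0 \<le> t \<Longrightarrow> 0 \<le> V t" and Q: "\<And>t. 0 \<le> t \<Longrightarrow> 0 \<le> Q t"
    and uc: "uniformly_continuous_on {0..} Q"
  shows "(Q \<longlongrightarrow> 0) at_top"
proof (rule order_tendstoI)
  fix e :: real assume "e < 0"
  then show "\<forall>\<^sub>F t in at_top. e < Q t"
    using Q by (intro eventually_at_top_linorderI[of 0]) force
next
  fix e :: real assume e: "0 < e"
  obtain h where h: "0 < h"
    and hQ: "\<And>s t. 0 \<le> s \<Longrightarrow> 0 \<le> t \<Longrightarrow> dist t s < h \<Longrightarrow> dist (Q t) (Q s) < e / 2"
    using uc e unfolding uniformly_continuous_on_def by (metis atLeast_iff half_gt_zero)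
  have V'': "((\<lambda>t. - V t) has_real_derivative Q t) (at t within {0..})" if "0 \<le> t" for t
    using DERIV_minus[OF V'[OF that]] by simp
  show "\<forall>\<^sub>F t in at_top. Q t < e"
  proof (rule ccontr)
    assume "\<not> ?thesis"
    then have freq: "\<exists>t\<ge>T. e \<le> Q t" for T
      by (auto simp: eventually_at_top_linorder not_less)
    \<comment> \<open>The induction collects \<open>n\<close> successive drops of \<open>V\<close>.
      Waiting \<open>h / 2\<close> instead of \<open>h\<close> keeps the whole interval strictly
      within the radius of uniform continuity.\<close>
    have "\<exists>t\<ge>0. V t \<le> V 0 - n * (e / 2 * (h / 2))" for n :: nat
    proof (induction n)
      case (Suc n)
      then obtain s where s: "0 \<le> s" "V s \<le> V 0 - n * (e / 2 * (h / 2))" by blast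
      obtain t where t: "s \<le> t" "e \<le> Q t" using freq by blast
      have "- V s + 0 * (t - s) \<le> - V t"
        by (rule DERIV_within_imp_growth[OF V'']) (use s t Q in auto)
      moreover have "- V t + e / 2 * (t + h / 2 - t) \<le> - V (t + h / 2)"
      proof (rule DERIV_within_imp_growth[OF V''])
        fix r assume r: "t \<le> r" "r \<le> t + h / 2"
        with s t h have "dist (Q r) (Q t) < e / 2" by (intro hQ) (auto simp: dist_real_def)
        with t show "e / 2 \<le> Q r" unfolding dist_real_def by linarith
      qed (use s t h in auto)
      ultimately have "V (t + h / 2) \<le> V 0 - Suc n * (e / 2 * (h / 2))"
        using s by (simp only: of_nat_Suc distrib_right add_diff_cancel_left')
      then show ?case using s t h by (intro exI[of _ "t + h / 2"]) auto
    qed auto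
    moreover obtain n :: nat where "V 0 < n * (e / 2 * (h / 2))"
      using reals_Archimedean3[of "e / 2 * (h / 2)"] e h by auto
    ultimately show False using V by (metis diff_less_0_iff_less leD order.strict_trans1)
  qed
qed

text \<open>The predicate \<open>P\<close> selects the times: a trivial one yields the existence of
  some limit point, while staying away from a candidate limit yields a second limit point.\<close>

lemma bounded_sequence_limit_point:
  fixes f :: "real \<Rightarrow> 'a::heine_borel"
  assumes bdd: "bounded (f ` {0..})" and freq: "\<And>T. \<exists>t\<ge>T. P t"
  obtains s w where "filterlim s at_top sequentially" "(\<lambda>n. f (s n)) \<longlonglongrightarrow> w"
    "\<forall>n. P (s n)" "\<forall>n. 0 \<le> s n"
proof -
  have "\<forall>n::nat. \<exists>t\<ge>real n. P t" using freq by blast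
  then obtain r where r: "\<And>n. real n \<le> r n" "\<And>n. P (r n)" by metis
  have r0: "0 \<le> r n" for n using r(1)[of n] by linarith
  have "compact (closure (f ` {0..}))" using bdd by simp
  moreover have "\<forall>n. (f \<circ> r) n \<in> closure (f ` {0..})"
    using r0 by (auto intro!: subsetD[OF closure_subset])
  ultimately obtain w k where k: "strict_mono (k :: nat \<Rightarrow> nat)" "((f \<circ> r) \<circ> k) \<longlonglongrightarrow> w"
    by (meson compact_imp_seq_compact seq_compactE)
  have "filterlim r at_top sequentially"
    by (rule filterlim_at_top_mono[OF filterlim_real_sequentially]) (simp add: r)
  then have "filterlim (\<lambda>n. r (k n)) at_top sequentially"
    using filterlim_subseq[OF k(1)] by (rule filterlim_compose)
  then show thesis
    using k(2) r r0 by (intro that[of "\<lambda>n. r (k n)" w]) (auto simp: o_def)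
qed

text \<open>If convergence failed, the times at distance at least \<open>e\<close> from
  \<open>l\<close> would be unbounded and would have a limit point other than
  \<open>l\<close>.\<close>

lemma tendsto_at_top_unique_limit_point:
  fixes f :: "real \<Rightarrow> 'a::heine_borel"
  assumes bdd: "bounded (f ` {0..})"
    and uniq: "\<And>s w. filterlim s at_top sequentially \<Longrightarrow> (\<lambda>n. f (s n)) \<longlonglongrightarrow> w \<Longrightarrow>
      (\<And>n. 0 \<le> s n) \<Longrightarrow> w = l"
  shows "(f \<longlongrightarrow> l) at_top"
proof (rule tendstoI, rule ccontr)
  fix e :: real assume e: "0 < e" and "\<not> (\<forall>\<^sub>F t in at_top. dist (f t) l < e)"
  then have "\<exists>t\<ge>T. e \<le> dist (f t) l" for T
    by (auto simp: eventually_at_top_linorder not_less)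
  with bdd obtain s w where s: "filterlim s at_top sequentially"
    and w: "(\<lambda>n. f (s n)) \<longlonglongrightarrow> w" and far: "\<forall>n. e \<le> dist (f (s n)) l"
    and s0: "\<forall>n. 0 \<le> s n"
    by (rule bounded_sequence_limit_point)
  have "w = l" using s w by (rule uniq) (use s0 in simp)
  with w have "(\<lambda>n. dist (f (s n)) l) \<longlonglongrightarrow> 0" by (metis tendsto_dist_iff)
  then have "e \<le> 0" by (rule LIMSEQ_le_const) (use far in auto)
  with e show False by simp
qed

section \<open>Solutions in the cube: bounds, uniform continuity, invariance of faces\<close>

lemma susceptibility_mult_nth:
  "((susceptibility x ** E) *v y) $ i = (1/2) * (1 - x $ i) * (E *v y) $ i"
proof -
  have "susceptibility x = diag (\<chi> i. (1/2) * (1 - x $ i))"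
    by (simp add: susceptibility_def diag_def mat_def vec_eq_iff)
  then show ?thesis by (simp add: diag_mult_vec_nth)
qed

lemma solution_range:
  assumes "solution E x" "0 \<le> t"
  shows "x t \<in> cbox (-1) 1" "-1 \<le> x t $ i" "x t $ i \<le> 1"
  using assms by (auto simp: solution_def mem_box_cart)

lemma solution_bounded:
  assumes "solution E x"
  shows "bounded (x ` {0..})"
  by (rule bounded_subset[OF bounded_cbox]) (use solution_range(1)[OF assms] in auto)

lemma solution_nth_deriv:
  assumes "solution E x" "0 \<le> t"
  shows "((\<lambda>t. x t $ i) has_real_derivative (1/2) * (1 - x t $ i) * (E *v x t) $ i)
    (at t within {0..})"
proof -
  have "(x has_vector_derivative (susceptibility (x t) ** E) *v x t) (at t within {0..})"
    using assms by (simp add: solution_def)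
  from bounded_linear.has_vector_derivative[OF bounded_linear_vec_nth[of i] this] show ?thesis
    by (simp add: has_real_derivative_iff_has_vector_derivative susceptibility_mult_nth)
qed

lemma solution_linear_image_bound:
  assumes "solution E x"
  obtains K where "\<And>t. 0 \<le> t \<Longrightarrow> \<bar>(E *v x t) $ i\<bar> \<le> K"
proof -
  have "compact ((\<lambda>y. (E *v y) $ i) ` cbox (-1) 1)"
    by (intro compact_continuous_image continuous_intros linear_continuous_on
        matrix_vector_mul_bounded_linear compact_cbox)
  then have "bounded ((\<lambda>y. (E *v y) $ i) ` cbox (-1) 1)" by (rule compact_imp_bounded)
  then show thesis using solution_range(1)[OF assms] that by (auto simp: bounded_iff)
qed

text \<open>The vector field is bounded on the compact cube, so a solution is Lipschitz; Barbalat's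
  argument relies on this.\<close>

lemma solution_uniformly_continuous:
  assumes sol: "solution E x"
  shows "uniformly_continuous_on {0..} x"
proof -
  have eq: "(\<lambda>y. (susceptibility y ** E) *v y) = (\<lambda>y. \<chi> i. (1/2) * (1 - y $ i) * (E *v y) $ i)"
    by (simp add: fun_eq_iff vec_eq_iff susceptibility_mult_nth)
  have "continuous_on (cbox (-1) 1) (\<lambda>y. (susceptibility y ** E) *v y)"
    unfolding eq
    by (intro continuous_intros linear_continuous_on matrix_vector_mul_bounded_linear)
  then have "compact ((\<lambda>y. (susceptibility y ** E) *v y) ` cbox (-1) 1)"
    by (rule compact_continuous_image) (rule compact_cbox)
  then have "bounded ((\<lambda>y. (susceptibility y ** E) *v y) ` cbox (-1) 1)"
    by (rule compact_imp_bounded)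
  then obtain K where K: "0 < K" "\<And>y. y \<in> cbox (-1) 1 \<Longrightarrow> norm ((susceptibility y ** E) *v y) \<le> K"
    unfolding bounded_pos by blast
  have "K-lipschitz_on {0..} x"
  proof (rule bounded_derivative_imp_lipschitz)
    show "(x has_derivative (\<lambda>h. h *\<^sub>R ((susceptibility (x t) ** E) *v x t))) (at t within {0..})"
      if "t \<in> {0..}" for t
      using sol that by (simp add: solution_def has_vector_derivative_def)
    show "onorm (\<lambda>h. h *\<^sub>R ((susceptibility (x t) ** E) *v x t)) \<le> K" if "t \<in> {0..}" for t
      using that K solution_range(1)[OF sol, of t]
      by (intro onorm_bound) (simp_all add: mult.commute[of K] mult_left_mono)
  qed (use K in auto)
  then show ?thesis by (rule lipschitz_on_uniformly_continuous)
qed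

text \<open>A Gronwall argument: the gap \<open>q = 1 - x_i\<close> satisfies
  \<open>q' = - q (E x)_i / 2\<close> with a bounded factor, so \<open>q exp (- K t)\<close> is
  nonincreasing and a gap that starts at 0 stays 0.\<close>

lemma solution_face_invariant:
  assumes sol: "solution E x" and "x 0 $ i = 1" and t: "0 \<le> t"
  shows "x t $ i = 1"
proof -
  obtain K where K: "\<And>t. 0 \<le> t \<Longrightarrow> \<bar>(E *v x t) $ i\<bar> \<le> K"
    using solution_linear_image_bound[OF sol, of i] by blast
  define g where "g t = - ((1 - x t $ i) * exp (- K * t))" for t
  have "g 0 + 0 * (t - 0) \<le> g t"
  proof (rule DERIV_within_imp_growth)
    show "(g has_real_derivative (1 - x t $ i) * exp (- K * t) * ((1/2) * (E *v x t) $ i + K))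
       (at t within {0..})" if "0 \<le> t" for t
      unfolding g_def
      by (rule derivative_eq_intros solution_nth_deriv[OF sol] that refl)+ (simp add: algebra_simps)
    show "0 \<le> (1 - x t $ i) * exp (- K * t) * ((1/2) * (E *v x t) $ i + K)" if "0 \<le> t" for t
      using K[OF that] solution_range[OF sol that] by (auto intro!: mult_nonneg_nonneg)
  qed (use t in auto)
  with assms have "(1 - x t $ i) * exp (- K * t) \<le> 0" by (simp add: g_def)
  with solution_range(3)[OF sol t, of i] show ?thesis by (simp add: mult_le_0_iff)
qed

text \<open>The Gronwall argument in the other direction: \<open>(1 - x_i) exp (K t)\<close> is
  nondecreasing, so a positive gap cannot close in finite time.\<close>

lemma solution_interior_invariant:
  assumes sol: "solution E x" and "x 0 $ i < 1" and t: "0 \<le> t"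
  shows "x t $ i < 1"
proof -
  obtain K where K: "\<And>t. 0 \<le> t \<Longrightarrow> \<bar>(E *v x t) $ i\<bar> \<le> K"
    using solution_linear_image_bound[OF sol, of i] by blast
  define g where "g t = (1 - x t $ i) * exp (K * t)" for t
  have "g 0 + 0 * (t - 0) \<le> g t"
  proof (rule DERIV_within_imp_growth)
    show "(g has_real_derivative (1 - x t $ i) * exp (K * t) * (K - (1/2) * (E *v x t) $ i))
       (at t within {0..})" if "0 \<le> t" for t
      unfolding g_def
      by (rule derivative_eq_intros solution_nth_deriv[OF sol] that refl)+ (simp add: algebra_simps)
    show "0 \<le> (1 - x t $ i) * exp (K * t) * (K - (1/2) * (E *v x t) $ i)" if "0 \<le> t" for t
      using K[OF that] solution_range[OF sol that] by (auto intro!: mult_nonneg_nonneg)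
  qed (use t in auto)
  with assms have "0 < (1 - x t $ i) * exp (K * t)" by (simp add: g_def)
  then show ?thesis by (simp add: zero_less_mult_iff)
qed

section \<open>The Lyapunov function\<close>

text \<open>The Volterra function known from Lotka-Volterra systems: nonnegative on the positive
  reals, zero only at 1, and unbounded near 0.\<close>

definition log_gap :: "real \<Rightarrow> real" where
  "log_gap u = u - 1 - ln u"

lemma log_gap_nonneg: "0 < u \<Longrightarrow> 0 \<le> log_gap u"
  using ln_le_minus_one[of u] by (simp add: log_gap_def)

lemma log_gap_eq_0D: "0 < u \<Longrightarrow> log_gap u = 0 \<Longrightarrow> u = 1"
  using ln_eq_minus_one[of u] by (simp add: log_gap_def)

text \<open>From \<open>ln u \<ge> u - 1 - K\<close> and \<open>u > 0\<close>. A bound on the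
  Lyapunov function thereby becomes a positive distance from the face where a coordinate is
  1.\<close>

lemma log_gap_bound: "0 < u \<Longrightarrow> log_gap u \<le> K \<Longrightarrow> exp (- 1 - K) \<le> u"
  by (subst ln_ge_iff[symmetric]) (simp_all add: log_gap_def)

text \<open>The sum leaves out the coordinates in \<open>S\<close>, where \<open>1 - a_i\<close>
  will be 0. The factor 2 offsets the one half in the susceptibility and \<open>1 - a_i\<close>
  clears the denominator produced by differentiation.\<close>

definition lyapunov :: "real^'n \<Rightarrow> 'n set \<Rightarrow> real^'n \<Rightarrow> real^'n \<Rightarrow> real" where
  "lyapunov g S a y = (\<Sum>i\<in>-S. 2 * g $ i * (1 - a $ i) * log_gap ((1 - y $ i) / (1 - a $ i)))"

lemma tendsto_lyapunov:
  assumes "(f \<longlongrightarrow> w) F" and "\<And>i. i \<notin> S \<Longrightarrow> w $ i < 1" and "\<And>i. i \<notin> S \<Longrightarrow> a $ i < 1"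
  shows "((\<lambda>t. lyapunov g S a (f t)) \<longlongrightarrow> lyapunov g S a w) F"
  unfolding lyapunov_def log_gap_def
  by (rule tendsto_intros assms | use assms in force)+

text \<open>\<open>S\<close> holds the coordinates that stay at 1 and \<open>a\<close> is the
  equilibrium at the centre of the Lyapunov function: off \<open>S\<close> it satisfies
  \<open>(E a)_i = 0\<close>, on \<open>S\<close> its susceptibility vanishes. The semidefiniteness
  and rank conditions enter through their consequences for the form.\<close>

definition frozen_solution ::
  "real^'n^'n \<Rightarrow> (real \<Rightarrow> real^'n) \<Rightarrow> 'n set \<Rightarrow> real^'n \<Rightarrow> real^'n \<Rightarrow> bool" where
  "frozen_solution E x S a g \<longleftrightarrow> solution E x \<and>
     (\<forall>i\<in>S. x 0 $ i = 1 \<and> a $ i = 1) \<and>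
     (\<forall>i\<in>-S. x 0 $ i < 1 \<and> a $ i < 1 \<and> (E *v a) $ i = 0) \<and>
     (\<forall>i. 0 < g $ i) \<and>
     (\<forall>w. w \<bullet> ((diag g ** E) *v w) \<le> 0) \<and>
     (\<forall>w. w \<bullet> ((diag g ** E) *v w) = 0 \<longrightarrow> E *v w = 0)"

lemma
  assumes "frozen_solution E x S a g"
  shows frozen_solution_solution: "solution E x"
    and frozen_solution_frozen: "i \<in> S \<Longrightarrow> a $ i = 1"
    and frozen_solution_free: "i \<notin> S \<Longrightarrow> a $ i < 1"
    and frozen_solution_equilibrium: "i \<notin> S \<Longrightarrow> (E *v a) $ i = 0"
    and frozen_solution_weight_pos: "0 < g $ i"
    and frozen_solution_form_nonpos: "w \<bullet> ((diag g ** E) *v w) \<le> 0"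
    and frozen_solution_form_zero: "w \<bullet> ((diag g ** E) *v w) = 0 \<Longrightarrow> E *v w = 0"
  using assms unfolding frozen_solution_def by blast+

lemma frozen_solution_free_at:
  assumes "frozen_solution E x S a g" "i \<notin> S" "0 \<le> t"
  shows "x t $ i < 1"
  using assms unfolding frozen_solution_def by (blast intro: solution_interior_invariant)

lemma frozen_solution_frozen_at:
  assumes "frozen_solution E x S a g" "i \<in> S" "0 \<le> t"
  shows "x t $ i = 1"
  using assms unfolding frozen_solution_def by (blast intro: solution_face_invariant)

lemma lyapunov_term_nonneg:
  assumes fs: "frozen_solution E x S a g" and "i \<notin> S" "y $ i < 1"
  shows "0 \<le> 2 * g $ i * (1 - a $ i) * log_gap ((1 - y $ i) / (1 - a $ i))"
  using assms frozen_solution_weight_pos[OF fs, of i] frozen_solution_free[OF fs, of i]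
  by (auto intro!: mult_nonneg_nonneg log_gap_nonneg)

lemma frozen_solution_lyapunov_nonneg:
  assumes fs: "frozen_solution E x S a g" and t: "0 \<le> t"
  shows "0 \<le> lyapunov g S a (x t)"
  unfolding lyapunov_def
  by (intro sum_nonneg lyapunov_term_nonneg[OF fs] frozen_solution_free_at[OF fs] t) auto

lemma frozen_solution_lyapunov_deriv:
  assumes fs: "frozen_solution E x S a g" and t: "0 \<le> t"
  shows "((\<lambda>t. lyapunov g S a (x t)) has_real_derivative (x t - a) \<bullet> ((diag g ** E) *v (x t - a))) (at t within {0..})"
proof -
  have summand: "((\<lambda>t. 2 * g $ i * (1 - a $ i) * log_gap ((1 - x t $ i) / (1 - a $ i)))
      has_real_derivative g $ i * (x t - a) $ i * (E *v (x t - a)) $ i) (at t within {0..})"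
    if i: "i \<notin> S" for i
  proof -
    have pos: "0 < 1 - a $ i" "0 < 1 - x t $ i"
      using frozen_solution_free[OF fs] frozen_solution_free_at[OF fs] i t by auto
    define D where "D = (1/2) * (1 - x t $ i) * (E *v x t) $ i"
    have D: "((\<lambda>t. x t $ i) has_real_derivative D) (at t within {0..})"
      unfolding D_def by (rule solution_nth_deriv[OF frozen_solution_solution[OF fs] t])
    have "((\<lambda>t. 2 * g $ i * (1 - a $ i) * log_gap ((1 - x t $ i) / (1 - a $ i)))
      has_real_derivative 2 * g $ i * (1 - a $ i) *
        (- D / (1 - a $ i) - (- D / (1 - a $ i)) / ((1 - x t $ i) / (1 - a $ i))))
      (at t within {0..})"
      unfolding log_gap_def
      by (rule derivative_eq_intros D refl | use pos in \<open>simp\<close>)+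
    also have "2 * g $ i * (1 - a $ i) *
        (- D / (1 - a $ i) - (- D / (1 - a $ i)) / ((1 - x t $ i) / (1 - a $ i)))
      = g $ i * (x t - a) $ i * (E *v x t) $ i"
    proof -
      \<comment> \<open>With \<open>p = 1 - a_i\<close> and \<open>q = 1 - x_i\<close>, the weight
        cancels the susceptibility and the denominators and leaves
        \<open>p - q = x_i - a_i\<close>.\<close>
      have "2 * c * p * (- ((1/2) * q * e) / p - (- ((1/2) * q * e) / p) / (q / p)) = c * (p - q) * e"
        if "0 < p" "0 < q" for c e p q :: real
        using that by (simp add: field_simps)
      from this[OF pos, of "g $ i" "(E *v x t) $ i"] show ?thesis by (simp add: D_def)
    qed
    \<comment> \<open>The equilibrium equation at a free coordinate allows centring the second
      factor at \<open>a\<close> as well.\<close>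
    also have "(E *v x t) $ i = (E *v (x t - a)) $ i"
      using frozen_solution_equilibrium[OF fs i] by (simp add: matrix_vector_mult_diff_distrib)
    finally show ?thesis .
  qed
  have "((\<lambda>t. lyapunov g S a (x t)) has_real_derivative (\<Sum>i\<in>-S. g $ i * (x t - a) $ i * (E *v (x t - a)) $ i))
      (at t within {0..})"
    unfolding lyapunov_def by (rule DERIV_sum) (use summand in auto)
  \<comment> \<open>On \<open>S\<close> both \<open>x\<close> and \<open>a\<close> equal 1, so the
    missing summands are 0 and the full quadratic form appears.\<close>
  also have "(\<Sum>i\<in>-S. g $ i * (x t - a) $ i * (E *v (x t - a)) $ i) =
      (\<Sum>i\<in>UNIV. g $ i * (x t - a) $ i * (E *v (x t - a)) $ i)"
    using frozen_solution_frozen_at[OF fs _ t] frozen_solution_frozen[OF fs]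
    by (intro sum.mono_neutral_left) auto
  finally show ?thesis unfolding quadratic_form_eq .
qed

lemma frozen_solution_lyapunov_antimono:
  assumes fs: "frozen_solution E x S a g" and st: "0 \<le> s" "s \<le> t"
  shows "lyapunov g S a (x t) \<le> lyapunov g S a (x s)"
proof -
  have "- lyapunov g S a (x s) + 0 * (t - s) \<le> - lyapunov g S a (x t)"
    by (rule DERIV_within_imp_growth[OF DERIV_minus[OF frozen_solution_lyapunov_deriv[OF fs]]])
      (use st frozen_solution_form_nonpos[OF fs] in auto)
  then show ?thesis by simp
qed

text \<open>Barbalat's argument applied to the Lyapunov function. Uniform continuity comes from
  compactness of the cube for the form, and from the Lipschitz bound for the solution.\<close>

lemma frozen_solution_form_tendsto_0:
  assumes fs: "frozen_solution E x S a g"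
  shows "((\<lambda>t. - ((x t - a) \<bullet> ((diag g ** E) *v (x t - a)))) \<longlongrightarrow> 0) at_top"
proof (rule barbalat_Lyapunov[of "\<lambda>t. lyapunov g S a (x t)"])
  have "continuous_on (cbox (-1) 1) (\<lambda>y. - ((y - a) \<bullet> ((diag g ** E) *v (y - a))))"
    by (intro continuous_intros
        bounded_linear.continuous_on[OF matrix_vector_mul_bounded_linear])
  then have "uniformly_continuous_on (cbox (-1) 1) (\<lambda>y. - ((y - a) \<bullet> ((diag g ** E) *v (y - a))))"
    by (rule compact_uniformly_continuous) (rule compact_cbox)
  moreover have "x ` {0..} \<subseteq> cbox (-1) 1"
    using solution_range(1)[OF frozen_solution_solution[OF fs]] by auto
  ultimately have "uniformly_continuous_on (x ` {0..})
      (\<lambda>y. - ((y - a) \<bullet> ((diag g ** E) *v (y - a))))"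
    unfolding uniformly_continuous_on_def by (meson subset_iff)
  from uniformly_continuous_on_compose[OF solution_uniformly_continuous[OF frozen_solution_solution[OF fs]] this]
  show "uniformly_continuous_on {0..} (\<lambda>t. - ((x t - a) \<bullet> ((diag g ** E) *v (x t - a))))" .
qed
  (use frozen_solution_lyapunov_deriv[OF fs] frozen_solution_lyapunov_nonneg[OF fs] frozen_solution_form_nonpos[OF fs] in auto)

text \<open>By continuity the form vanishes at \<open>w - a\<close>, and zeros of the form lie in
  the kernel of \<open>E\<close>.\<close>

lemma limit_point_kernel:
  assumes fs: "frozen_solution E x S a g"
    and s: "filterlim s at_top sequentially" "\<And>n. 0 \<le> s n" and w: "(\<lambda>n. x (s n)) \<longlonglongrightarrow> w"
  shows "E *v (w - a) = 0"
proof -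
  have "(\<lambda>n. - ((x (s n) - a) \<bullet> ((diag g ** E) *v (x (s n) - a)))) \<longlonglongrightarrow>
      - ((w - a) \<bullet> ((diag g ** E) *v (w - a)))"
    by (intro tendsto_intros w bounded_linear.tendsto[OF matrix_vector_mul_bounded_linear])
  moreover have "(\<lambda>n. - ((x (s n) - a) \<bullet> ((diag g ** E) *v (x (s n) - a)))) \<longlonglongrightarrow> 0"
    using filterlim_compose[OF frozen_solution_form_tendsto_0[OF fs] s(1)] .
  ultimately have "- ((w - a) \<bullet> ((diag g ** E) *v (w - a))) = 0"
    by (rule LIMSEQ_unique)
  then show ?thesis by (intro frozen_solution_form_zero[OF fs]) simp
qed

lemma limit_point_frozen:
  assumes fs: "frozen_solution E x S a g"
    and s: "filterlim s at_top sequentially" "\<And>n. 0 \<le> s n" and w: "(\<lambda>n. x (s n)) \<longlonglongrightarrow> w"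
    and i: "i \<in> S"
  shows "w $ i = 1"
  using tendsto_vec_nth[OF w, of i] frozen_solution_frozen_at[OF fs i s(2)]
  by (simp add: LIMSEQ_const_iff)

lemma limit_point_ge:
  assumes fs: "frozen_solution E x S a g"
    and s: "filterlim s at_top sequentially" "\<And>n. 0 \<le> s n" and w: "(\<lambda>n. x (s n)) \<longlonglongrightarrow> w"
  shows "-1 \<le> w $ i"
  by (rule LIMSEQ_le_const[OF tendsto_vec_nth[OF w]])
    (use solution_range(2)[OF frozen_solution_solution[OF fs] s(2)] in auto)

text \<open>Every summand of the Lyapunov function is nonnegative, hence bounded by the initial
  value of the whole sum. This keeps \<open>1 - x_i\<close> above a positive constant that does not
  depend on time, so the strict inequality survives in the limit.\<close>

lemma limit_point_free:
  assumes fs: "frozen_solution E x S a g"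
    and s: "filterlim s at_top sequentially" "\<And>n. 0 \<le> s n" and w: "(\<lambda>n. x (s n)) \<longlonglongrightarrow> w"
    and i: "i \<notin> S"
  shows "w $ i < 1"
proof -
  define c where "c = 2 * g $ i * (1 - a $ i)"
  have a: "0 < 1 - a $ i" using frozen_solution_free[OF fs i] by simp
  then have c: "0 < c" using frozen_solution_weight_pos[OF fs, of i] by (simp add: c_def)
  have "exp (- 1 - lyapunov g S a (x 0) / c) * (1 - a $ i) \<le> 1 - x t $ i" if t: "0 \<le> t" for t
  proof -
    have "c * log_gap ((1 - x t $ i) / (1 - a $ i)) \<le> lyapunov g S a (x t)"
      unfolding lyapunov_def c_def
      by (rule member_le_sum, use i in simp, rule lyapunov_term_nonneg[OF fs], use t frozen_solution_free_at[OF fs] in auto)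
    also have "\<dots> \<le> lyapunov g S a (x 0)"
      by (rule frozen_solution_lyapunov_antimono[OF fs]) (use t in auto)
    finally have "log_gap ((1 - x t $ i) / (1 - a $ i)) \<le> lyapunov g S a (x 0) / c"
      using c by (simp add: field_simps)
    then have "exp (- 1 - lyapunov g S a (x 0) / c) \<le> (1 - x t $ i) / (1 - a $ i)"
      using frozen_solution_free_at[OF fs i t] a by (intro log_gap_bound) auto
    then show ?thesis using a by (simp add: pos_le_divide_eq)
  qed
  then have "\<exists>N. \<forall>n\<ge>N. exp (- 1 - lyapunov g S a (x 0) / c) * (1 - a $ i) \<le> 1 - x (s n) $ i"
    using s(2) by blast
  moreover have "(\<lambda>n. 1 - x (s n) $ i) \<longlonglongrightarrow> 1 - w $ i"
    by (intro tendsto_intros w)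
  ultimately have "exp (- 1 - lyapunov g S a (x 0) / c) * (1 - a $ i) \<le> 1 - w $ i"
    by (intro LIMSEQ_le_const)
  moreover have "0 < exp (- 1 - lyapunov g S a (x 0) / c) * (1 - a $ i)" using a by simp
  ultimately show ?thesis by linarith
qed

text \<open>For any limit point \<open>w\<close>, the difference \<open>w - a\<close> lies in the
  kernel and vanishes on \<open>S\<close>, so the kernel hypothesis leaves \<open>a\<close> as the
  only limit point.\<close>

lemma converges_of_kernel:
  assumes fs: "frozen_solution E x S a g"
    and kernel: "\<And>z. E *v z = 0 \<Longrightarrow> (\<And>i. i \<in> S \<Longrightarrow> z $ i = 0) \<Longrightarrow> z = 0"
  shows "(x \<longlongrightarrow> a) at_top"
proof (rule tendsto_at_top_unique_limit_point[OF solution_bounded[OF frozen_solution_solution[OF fs]]])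
  fix s w assume sw: "filterlim s at_top sequentially" "(\<lambda>n. x (s n)) \<longlonglongrightarrow> w" "\<And>n. 0 \<le> s n"
  have "w - a = 0"
    by (rule kernel) (simp_all add: limit_point_kernel[OF fs sw(1,3,2)]
      limit_point_frozen[OF fs sw(1,3,2)] frozen_solution_frozen[OF fs])
  then show "w = a" by simp
qed

text \<open>The Lyapunov function centred at \<open>a\<close> is nonincreasing and tends to 0 along
  the given times, so it vanishes at every limit point, and its only admissible zero is
  \<open>a\<close>.\<close>

lemma converges_of_limit_point:
  assumes fs: "frozen_solution E x S a g"
    and s: "filterlim s at_top sequentially" "\<And>n. 0 \<le> s n" "(\<lambda>n. x (s n)) \<longlonglongrightarrow> a"
  shows "(x \<longlongrightarrow> a) at_top"
proof (rule tendsto_at_top_unique_limit_point[OF solution_bounded[OF frozen_solution_solution[OF fs]]])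
  fix r w assume rw: "filterlim r at_top sequentially" "(\<lambda>n. x (r n)) \<longlonglongrightarrow> w" "\<And>n. 0 \<le> r n"
  have free_w: "w $ i < 1" if "i \<notin> S" for i
    by (rule limit_point_free[OF fs rw(1,3,2) that])
  have V_s: "(\<lambda>n. lyapunov g S a (x (s n))) \<longlonglongrightarrow> lyapunov g S a a"
    by (rule tendsto_lyapunov[OF s(3) frozen_solution_free[OF fs] frozen_solution_free[OF fs]])
  have V_r: "(\<lambda>n. lyapunov g S a (x (r n))) \<longlonglongrightarrow> lyapunov g S a w"
    by (rule tendsto_lyapunov[OF rw(2) free_w frozen_solution_free[OF fs]])
  have "1 - a $ i \<noteq> 0" if "i \<notin> S" for i using frozen_solution_free[OF fs that] by simp
  then have "lyapunov g S a a = 0" by (simp add: lyapunov_def log_gap_def)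
  have "lyapunov g S a w \<le> lyapunov g S a (x (s n))" for n
  proof (rule LIMSEQ_le_const2[OF V_r])
    have "\<forall>\<^sub>F k in sequentially. s n \<le> r k"
      using rw(1) by (simp add: filterlim_at_top)
    then show "\<exists>N. \<forall>k\<ge>N. lyapunov g S a (x (r k)) \<le> lyapunov g S a (x (s n))"
      unfolding eventually_sequentially using frozen_solution_lyapunov_antimono[OF fs s(2)] by blast
  qed
  then have "lyapunov g S a w \<le> 0"
    using LIMSEQ_le_const[OF V_s] \<open>lyapunov g S a a = 0\<close> by auto
  moreover have nn: "0 \<le> 2 * g $ i * (1 - a $ i) * log_gap ((1 - w $ i) / (1 - a $ i))"
    if "i \<in> - S" for i
    using that free_w by (intro lyapunov_term_nonneg[OF fs]) auto
  ultimately have "lyapunov g S a w = 0"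
    unfolding lyapunov_def by (meson order_antisym sum_nonneg)
  have zero: "2 * g $ i * (1 - a $ i) * log_gap ((1 - w $ i) / (1 - a $ i)) = 0" if "i \<notin> S" for i
    by (rule sum_nonneg_0[OF _ nn \<open>lyapunov g S a w = 0\<close>[unfolded lyapunov_def]])
      (use that in auto)
  have "w $ i = a $ i" for i
  proof (cases "i \<in> S")
    case True
    then show ?thesis using limit_point_frozen[OF fs rw(1,3,2)] frozen_solution_frozen[OF fs] by simp
  next
    case False
    then have "log_gap ((1 - w $ i) / (1 - a $ i)) = 0"
      using zero[OF False] frozen_solution_weight_pos[OF fs, of i] frozen_solution_free[OF fs, of i] by simp
    then have "(1 - w $ i) / (1 - a $ i) = 1"
      using False free_w frozen_solution_free[OF fs] by (intro log_gap_eq_0D) auto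
    then show ?thesis by (simp add: divide_eq_1_iff)
  qed
  then show "w = a" by (simp add: vec_eq_iff)
qed

section \<open>Convergence to equilibria\<close>

lemma infnorm_positive_vector:
  fixes v :: "real^'n"
  assumes "positive_vector v"
  shows "v $ i \<le> infnorm v" "0 < infnorm v" "\<exists>j. v $ j = infnorm v"
proof -
  have v: "0 < v $ i" for i using assms by (simp add: positive_vector_def)
  show le: "v $ i \<le> infnorm v" for i
    using component_le_infnorm_cart[of v i] by simp
  show "0 < infnorm v" using v le by (meson order.strict_trans2)
  have "infnorm v = Max (range (\<lambda>i. \<bar>v $ i\<bar>))"
    unfolding infnorm_cart by (subst cSup_eq_Max) (auto simp: full_SetCompr_eq)
  moreover have "Max (range (\<lambda>i. \<bar>v $ i\<bar>)) \<in> range (\<lambda>i. \<bar>v $ i\<bar>)" by (rule Max_in) auto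
  ultimately have "infnorm v \<in> range (\<lambda>i. \<bar>v $ i\<bar>)" by simp
  then obtain j where "infnorm v = \<bar>v $ j\<bar>" by blast
  then show "\<exists>j. v $ j = infnorm v" using v[of j] by (intro exI[of _ j]) simp
qed

lemma UNIV_sum_split:
  fixes f :: "'p::finite + 'q::finite \<Rightarrow> 'a::comm_monoid_add"
  shows "(\<Sum>k\<in>UNIV. f k) = (\<Sum>i\<in>UNIV. f (Inl i)) + (\<Sum>j\<in>UNIV. f (Inr j))"
  unfolding UNIV_sum by (subst sum.union_disjoint) (auto simp: sum.reindex)

lemma transpose_perm_matrix_mult_nth:
  assumes "bij \<pi>"
  shows "(transpose (perm_matrix \<pi>) *v y) $ \<pi> k = y $ k"
proof -
  have "(\<Sum>l\<in>UNIV. (if \<pi> k = \<pi> l then 1 else 0) * y $ l) = (\<Sum>l\<in>UNIV. if l = k then y $ l else 0)"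
    using bij_is_inj[OF assms] by (intro sum.cong) (auto simp: inj_eq)
  then show ?thesis
    by (simp add: matrix_vector_mult_def transpose_def perm_matrix_def)
qed

lemma perm_matrix_conjugate_nth:
  "(perm_matrix \<pi> ** E ** transpose (perm_matrix \<pi>)) $ k $ l = E $ \<pi> k $ \<pi> l"
  by (simp add: matrix_matrix_mult_def transpose_def perm_matrix_def
      if_distrib[of "\<lambda>a. a * _"] if_distrib[of "\<lambda>a. _ * a"] cong: if_cong)

lemma block_equilibrium:
  fixes \<pi> :: "'p::finite + 'q::finite \<Rightarrow> 'n::finite" and E :: "real^'n^'n"
  defines "M \<equiv> perm_matrix \<pi> ** E ** transpose (perm_matrix \<pi>)"
  assumes \<pi>: "bij \<pi>" and inv: "invertible (block22 M)"
  shows "(E *v (transpose (perm_matrix \<pi>) *v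
    join_blocks 1 (- (matrix_inv (block22 M) *v (block21 M *v 1))))) $ \<pi> (Inr q) = 0"
proof -
  define z where "z = - (matrix_inv (block22 M) *v (block21 M *v 1))"
  have "block22 M *v (matrix_inv (block22 M) *v c) = c" for c
    by (simp only: matrix_vector_mul_assoc matrix_inv_right inv matrix_vector_mul_lid)
  then have "block22 M *v z = - (block21 M *v 1)"
    by (simp only: z_def linear_neg matrix_vector_mul_linear)
  then have eq: "(block21 M *v 1) $ q + (block22 M *v z) $ q = 0" by simp
  define w where "w = transpose (perm_matrix \<pi>) *v join_blocks 1 z"
  have "(E *v w) $ \<pi> (Inr q) = (\<Sum>k\<in>UNIV. E $ \<pi> (Inr q) $ \<pi> k * w $ \<pi> k)"
    unfolding matrix_vector_mult_def vec_lambda_beta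
    using sum.reindex_bij_betw[OF \<pi>, of "\<lambda>j. E $ \<pi> (Inr q) $ j * w $ j"] by simp
  also have "\<dots> = (\<Sum>k\<in>UNIV. M $ Inr q $ k * join_blocks 1 z $ k)"
    by (simp only: M_def w_def perm_matrix_conjugate_nth transpose_perm_matrix_mult_nth[OF \<pi>])
  also have "\<dots> = (block21 M *v 1) $ q + (block22 M *v z) $ q"
    by (simp add: UNIV_sum_split matrix_vector_mult_def block21_def block22_def join_blocks_def)
  finally show ?thesis using eq by (simp add: w_def z_def)
qed

definition dissipative_system :: "real^'n^'n \<Rightarrow> real^'n \<Rightarrow> real^'n \<Rightarrow> bool" where
  "dissipative_system E g v \<longleftrightarrow> positive_vector v \<and> (\<forall>i. 0 < g $ i) \<and>
     negative_semidefinite (symmetric_part (diag g ** E)) \<and>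
     rank (symmetric_part (diag g ** E)) = rank E \<and>
     (\<forall>w. E *v w = 0 \<longrightarrow> (\<exists>c. w = c *\<^sub>R v))"

lemma
  assumes "dissipative_system E g v"
  shows dissipative_system_positive: "positive_vector v"
    and dissipative_system_kernel: "E *v w = 0 \<Longrightarrow> \<exists>c. w = c *\<^sub>R v"
  using assms unfolding dissipative_system_def by blast+

lemma frozen_solutionI:
  assumes ds: "dissipative_system E g v"
    and "solution E x"
    and "\<And>i. i \<in> S \<Longrightarrow> x 0 $ i = 1" "\<And>i. i \<notin> S \<Longrightarrow> x 0 $ i < 1"
    and "\<And>i. i \<in> S \<Longrightarrow> a $ i = 1" "\<And>i. i \<notin> S \<Longrightarrow> a $ i < 1"
    and "\<And>i. i \<notin> S \<Longrightarrow> (E *v a) $ i = 0"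
  shows "frozen_solution E x S a g"
proof -
  have nsd: "negative_semidefinite (symmetric_part (diag g ** E))"
    and rank: "rank (symmetric_part (diag g ** E)) = rank E" and g: "\<And>i. 0 < g $ i"
    using ds by (auto simp: dissipative_system_def)
  have "w \<bullet> ((diag g ** E) *v w) \<le> 0" for w
    using nsd by (simp add: negative_semidefinite_def inner_symmetric_part)
  then show ?thesis
    unfolding frozen_solution_def
    using assms(2-) g quadratic_form_zero_imp_kernel[OF nsd rank] by blast
qed

lemma converges_on_face:
  assumes ds: "dissipative_system E g v"
    and fs: "frozen_solution E x S a g" and S: "S \<noteq> {}"
  shows "(x \<longlongrightarrow> a) at_top"
proof (rule converges_of_kernel[OF fs])
  fix z assume "E *v z = 0" and z: "\<And>i. i \<in> S \<Longrightarrow> z $ i = 0"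
  then obtain c where "z = c *\<^sub>R v" using dissipative_system_kernel[OF ds] by blast
  moreover obtain i where "i \<in> S" using S by blast
  ultimately show "z = 0" using z[of i] dissipative_system_positive[OF ds]
    by (auto simp: positive_vector_def less_le)
qed

lemma converges_interior:
  assumes ds: "dissipative_system E g v"
    and sol: "solution E x" and x0: "\<And>i. x 0 $ i < 1"
  shows "\<exists>\<alpha>. - 1 / infnorm v \<le> \<alpha> \<and> \<alpha> < 1 / infnorm v \<and> (x \<longlongrightarrow> \<alpha> *\<^sub>R v) at_top"
proof -
  have fs0: "frozen_solution E x {} 0 g"
    by (rule frozen_solutionI[OF ds sol]) (use x0 in auto)
  obtain s w where s: "filterlim s at_top sequentially" "(\<lambda>n. x (s n)) \<longlonglongrightarrow> w" "\<forall>n. 0 \<le> s n"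
    by (rule bounded_sequence_limit_point[OF solution_bounded[OF sol], of "\<lambda>_. True"]) auto
  have s0: "0 \<le> s n" for n using s(3) by blast
  have Ew: "E *v w = 0"
    using limit_point_kernel[OF fs0 s(1) s0 s(2)] by simp
  then obtain \<alpha> where \<alpha>: "w = \<alpha> *\<^sub>R v" using dissipative_system_kernel[OF ds] by blast
  have w1: "w $ i < 1" for i
    by (rule limit_point_free[OF fs0 s(1) s0 s(2)]) simp
  have "frozen_solution E x {} w g"
    by (rule frozen_solutionI[OF ds sol]) (use x0 w1 Ew in auto)
  then have "(x \<longlongrightarrow> w) at_top"
    by (rule converges_of_limit_point) (fact s s0)+
  moreover obtain j where "v $ j = infnorm v" using infnorm_positive_vector(3)[OF dissipative_system_positive[OF ds]] by blast
  with w1[of j] limit_point_ge[OF fs0 s(1) s0 s(2), of j]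
  have "- 1 / infnorm v \<le> \<alpha>" "\<alpha> < 1 / infnorm v"
    using infnorm_positive_vector(2)[OF dissipative_system_positive[OF ds]] \<alpha>
    by (simp_all add: field_simps)
  ultimately show ?thesis using \<alpha> by blast
qed

lemma converges_block:
  fixes \<pi> :: "'p::finite + 'q::finite \<Rightarrow> 'n::finite" and E :: "real^'n^'n"
  defines "M \<equiv> perm_matrix \<pi> ** E ** transpose (perm_matrix \<pi>)"
  defines "z \<equiv> - (matrix_inv (block22 M) *v (block21 M *v 1))"
  assumes ds: "dissipative_system E g v"
    and \<pi>: "bij \<pi>" and S: "range (\<pi> \<circ> Inl) = S" "S \<noteq> {}"
    and inv: "invertible (block22 M)" and z: "\<And>k. z $ k < 1"
    and sol: "solution E x"
    and x0: "\<And>i. i \<in> S \<Longrightarrow> x 0 $ i = 1" "\<And>i. i \<notin> S \<Longrightarrow> x 0 $ i < 1"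
  shows "(x \<longlongrightarrow> transpose (perm_matrix \<pi>) *v join_blocks 1 z) at_top"
proof (rule converges_on_face[OF ds frozen_solutionI[OF ds sol x0] S(2)])
  let ?a = "transpose (perm_matrix \<pi>) *v join_blocks 1 z"
  have a: "?a $ \<pi> k = join_blocks 1 z $ k" for k
    by (rule transpose_perm_matrix_mult_nth[OF \<pi>])
  have Inr: "\<exists>q. i = \<pi> (Inr q)" if "i \<notin> S" for i
  proof -
    obtain k where "i = \<pi> k" using bij_is_surj[OF \<pi>] by (metis surjD)
    then show ?thesis using that S(1) by (cases k) auto
  qed
  show "?a $ i = 1" if "i \<in> S" for i
    using that a S(1) by (auto simp: join_blocks_def)
  show "?a $ i < 1" if "i \<notin> S" for i
    using Inr[OF that] a z by (auto simp: join_blocks_def)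
  show "(E *v ?a) $ i = 0" if "i \<notin> S" for i
    using Inr[OF that] block_equilibrium[OF \<pi> inv[unfolded M_def]] by (auto simp: z_def M_def)
qed auto

lemma converges_maximal_entries:
  assumes ds: "dissipative_system E g v"
    and Ev: "E *v v = 0" and sol: "solution E x"
    and x0: "\<And>i. v $ i = infnorm v \<Longrightarrow> x 0 $ i = 1" "\<And>i. v $ i \<noteq> infnorm v \<Longrightarrow> x 0 $ i < 1"
  shows "(x \<longlongrightarrow> (1 / infnorm v) *\<^sub>R v) at_top"
proof (rule converges_on_face[OF ds frozen_solutionI[OF ds sol]])
  let ?J = "{j. v $ j = infnorm v}" and ?a = "(1 / infnorm v) *\<^sub>R v"
  note inf = infnorm_positive_vector[OF dissipative_system_positive[OF ds]]
  show "?J \<noteq> {}" using inf(3) by auto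
  show "x 0 $ i = 1" if "i \<in> ?J" for i using that x0 by simp
  show "x 0 $ i < 1" if "i \<notin> ?J" for i using that x0 by simp
  show "?a $ i = 1" if "i \<in> ?J" for i using that inf(2) by simp
  show "?a $ i < 1" if "i \<notin> ?J" for i using that inf(1)[of i] inf(2) by simp
  show "(E *v ?a) $ i = 0" for i by (simp only: matrix_vector_mult_scaleR Ev) simp
qed

lemma mat_mult_vec: "mat d *v w = d *\<^sub>R (w :: real^'n)"
  by (simp add: vec_eq_iff matrix_vector_mult_def mat_def if_distrib[of "\<lambda>a. a * _"] cong: if_cong)

lemma diag_const:
  assumes "\<forall>i j. \<sigma> $ i = \<sigma> $ j"
  shows "diag \<sigma> = mat (\<sigma> $ k)"
  using assms by (metis (no_types, lifting) diag_def mat_def vec_eq_iff vec_lambda_beta)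

lemma assumptions_imp_shifted_eventually_positive:
  assumes "E = B - diag \<sigma>"
    and "(assumption1 B \<sigma> \<and> perron_vector B v) \<or> (assumption2 B \<sigma> C d \<and> perron_vector C v)"
  obtains M s where "eventually_positive M" "perron_vector M v" "E = M - mat s"
    "spectral_radius M \<le> s"
    "(assumption1 B \<sigma> \<and> (\<forall>i j. \<sigma> $ i = \<sigma> $ j \<and> \<sigma> $ j = spectral_radius B) \<or>
       assumption2 B \<sigma> C d \<and> d = spectral_radius C) \<longrightarrow> spectral_radius M = s"
  using assms(2)
proof
  assume A: "assumption1 B \<sigma> \<and> perron_vector B v"
  then have B: "eventually_positive B" "spectral_radius B \<le> \<sigma> $ undefined"
    and not2: "\<not> assumption2 B \<sigma> C d"
    unfolding assumption1_def assumption2_def by blast+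
  have "\<forall>i j. \<sigma> $ i = \<sigma> $ j" using A unfolding assumption1_def by blast
  then have "diag \<sigma> = mat (\<sigma> $ undefined)" by (rule diag_const)
  show thesis
  proof (rule that)
    show "E = B - mat (\<sigma> $ undefined)" by (simp only: assms(1) \<open>diag \<sigma> = _\<close>)
    show "(assumption1 B \<sigma> \<and> (\<forall>i j. \<sigma> $ i = \<sigma> $ j \<and> \<sigma> $ j = spectral_radius B) \<or>
       assumption2 B \<sigma> C d \<and> d = spectral_radius C) \<longrightarrow> spectral_radius B = \<sigma> $ undefined"
      using not2 by metis
  qed (use A B in blast)+
next
  assume A: "assumption2 B \<sigma> C d \<and> perron_vector C v"
  show thesis
  proof (rule that)
    show "E = C - mat d" using A unfolding assms(1) assumption2_def by blast
    show "(assumption1 B \<sigma> \<and> (\<forall>i j. \<sigma> $ i = \<sigma> $ j \<and> \<sigma> $ j = spectral_radius B) \<or>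
       assumption2 B \<sigma> C d \<and> d = spectral_radius C) \<longrightarrow> spectral_radius C = d"
      using A unfolding assumption1_def assumption2_def by metis
    show "eventually_positive C" "spectral_radius C \<le> d" "perron_vector C v"
      using A unfolding assumption2_def by blast+
  qed
qed

theorem theorem1:
  fixes B C E :: "real^'n^'n" and \<sigma> v :: "real^'n" and d :: real
  assumes "strongly_connected B"
    and "\<forall>i. B $ i $ i = 0"
    and "\<forall>i. 0 < \<sigma> $ i"
    and "E = B - diag \<sigma>"
    and "(assumption1 B \<sigma> \<and> perron_vector B v) \<or> (assumption2 B \<sigma> C d \<and> perron_vector C v)"
    and "\<exists>\<gamma>. (\<forall>i. 0 < \<gamma> $ i) \<and> negative_semidefinite (symmetric_part (diag \<gamma> ** E)) \<and>
           rank (symmetric_part (diag \<gamma> ** E)) = rank E"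
  shows
    "(\<forall>x. solution E x \<and> (\<forall>i. x 0 $ i < 1) \<longrightarrow>
        (\<exists>\<alpha>. - 1 / infnorm v \<le> \<alpha> \<and> \<alpha> < 1 / infnorm v \<and> (x \<longlongrightarrow> \<alpha> *\<^sub>R v) at_top))
     \<and>
     (\<forall>(I0 :: 'n set) (\<pi> :: 'p::finite + 'q::finite \<Rightarrow> 'n).
        I0 \<noteq> {} \<and> - I0 \<noteq> {} \<and> bij \<pi> \<and> range (\<pi> \<circ> Inl) = I0 \<longrightarrow>
        (let P = perm_matrix \<pi>;
             Ebar = P ** E ** transpose P;
             y2 = - (matrix_inv (block22 Ebar) *v (block21 Ebar *v 1));
             xstar = transpose P *v join_blocks 1 y2
         in invertible (block22 Ebar) \<and> (\<forall>k. - 1 \<le> y2 $ k \<and> y2 $ k < 1) \<longrightarrow>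
            (\<forall>x. solution E x \<and> (\<forall>i\<in>I0. x 0 $ i = 1) \<and>
                 (\<forall>i. i \<notin> I0 \<longrightarrow> - 1 \<le> x 0 $ i \<and> x 0 $ i < 1) \<longrightarrow>
               (x \<longlongrightarrow> xstar) at_top)))
     \<and>
     ((assumption1 B \<sigma> \<and> (\<forall>i j. \<sigma> $ i = \<sigma> $ j \<and> \<sigma> $ j = spectral_radius B) \<or>
       assumption2 B \<sigma> C d \<and> d = spectral_radius C) \<and> v \<noteq> 1 \<longrightarrow>
        (let J = {j. v $ j = infnorm v}; \<beta> = 1 / infnorm v
         in \<forall>x. solution E x \<and> (\<forall>i\<in>J. x 0 $ i = 1) \<and>
                (\<forall>i. i \<notin> J \<longrightarrow> - 1 \<le> x 0 $ i \<and> x 0 $ i < 1) \<longrightarrow>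
              (x \<longlongrightarrow> \<beta> *\<^sub>R v) at_top))"
proof -
  obtain M s where M: "eventually_positive M" and pv: "perron_vector M v" and E: "E = M - mat s"
    and s: "spectral_radius M \<le> s"
    and critical: "(assumption1 B \<sigma> \<and> (\<forall>i j. \<sigma> $ i = \<sigma> $ j \<and> \<sigma> $ j = spectral_radius B) \<or>
       assumption2 B \<sigma> C d \<and> d = spectral_radius C) \<longrightarrow> spectral_radius M = s"
    using assms(4,5) by (rule assumptions_imp_shifted_eventually_positive)
  have v: "positive_vector v" and Mv: "M *v v = spectral_radius M *\<^sub>R v"
    using pv by (auto simp: perron_vector_def)
  have Ew: "E *v w = M *v w - s *\<^sub>R w" for w
    by (simp add: E matrix_vector_mult_diff_rdistrib mat_mult_vec)
  obtain g where g: "\<forall>i. 0 < g $ i" "negative_semidefinite (symmetric_part (diag g ** E))"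
    "rank (symmetric_part (diag g ** E)) = rank E"
    using assms(6) by blast
  have "\<exists>c. w = c *\<^sub>R v" if "E *v w = 0" for w
    using that by (intro eventually_positive_eigenvector[OF M v Mv _ s]) (simp add: Ew)
  with v g have ds: "dissipative_system E g v"
    unfolding dissipative_system_def by blast
  have critical': "E *v v = 0" if "spectral_radius M = s"
    using that by (simp add: Ew Mv)
  show ?thesis
    unfolding Let_def
  proof (intro conjI allI impI)
    fix x assume "solution E x \<and> (\<forall>i. x 0 $ i < 1)"
    then show "\<exists>\<alpha>. - 1 / infnorm v \<le> \<alpha> \<and> \<alpha> < 1 / infnorm v \<and> (x \<longlongrightarrow> \<alpha> *\<^sub>R v) at_top"
      by (intro converges_interior[OF ds]) auto
  next
    fix S :: "'n set" and \<pi> :: "'p + 'q \<Rightarrow> 'n" and x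
    let ?M = "perm_matrix \<pi> ** E ** transpose (perm_matrix \<pi>)"
    let ?z = "- (matrix_inv (block22 ?M) *v (block21 ?M *v 1))"
    assume "S \<noteq> {} \<and> - S \<noteq> {} \<and> bij \<pi> \<and> range (\<pi> \<circ> Inl) = S"
      and "invertible (block22 ?M) \<and> (\<forall>k. - 1 \<le> ?z $ k \<and> ?z $ k < 1)"
      and "solution E x \<and> (\<forall>i\<in>S. x 0 $ i = 1) \<and> (\<forall>i. i \<notin> S \<longrightarrow> - 1 \<le> x 0 $ i \<and> x 0 $ i < 1)"
    then show "(x \<longlongrightarrow> transpose (perm_matrix \<pi>) *v join_blocks 1 ?z) at_top"
      by (intro converges_block[OF ds, of \<pi> S]) blast+
  next
    fix x
    assume "(assumption1 B \<sigma> \<and> (\<forall>i j. \<sigma> $ i = \<sigma> $ j \<and> \<sigma> $ j = spectral_radius B) \<or>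
       assumption2 B \<sigma> C d \<and> d = spectral_radius C) \<and> v \<noteq> 1"
      and "solution E x \<and> (\<forall>i\<in>{j. v $ j = infnorm v}. x 0 $ i = 1) \<and>
        (\<forall>i. i \<notin> {j. v $ j = infnorm v} \<longrightarrow> - 1 \<le> x 0 $ i \<and> x 0 $ i < 1)"
    then show "(x \<longlongrightarrow> (1 / infnorm v) *\<^sub>R v) at_top"
      using critical critical' by (intro converges_maximal_entries[OF ds]) blast+
  qed
qed

end
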